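(* Among the flat Lie algebras on $\mathfrak g_{3,1}$ given in the list of the context: (i) the associative ones are exactly $\mathfrak h_{0,3},\mathfrak h_{0,6},\mathfrak h_{6,1}$; (ii) the Novikov ones are exactly $\mathfrak h_{0,2},\mathfrak h_{0,3},\mathfrak h_{0,4},\mathfrak h_{0,5},\mathfrak h_{0,6},\mathfrak h_{4,1},\mathfrak h_{6,1}$; (iii) the bi-symmetric ones are exactly $\mathfrak h_{0,2},\mathfrak h_{0,3},\mathfrak h_{0,5},\mathfrak h_{0,6},\mathfrak h_{6,1}$; (iv) the complete ones are exactly $\mathfrak h_{0,2},\mathfrak h_{0,3},\mathfrak h_{0,5},\mathfrak h_{0,6},\mathfrak h_{6,1}$.
   Context: A flat Lie algebra is a real Lie algebra $\mathfrak g$ with a bilinear product $X\cdot Y=\nabla_XY$ such that $X\cdot Y-Y\cdot X=[X,Y]$ and $[X,Y]\cdot Z=X\cdot(Y\cdot Z)-Y\cdot(X\cdot Z)$. Put $R_X(Y)=Y\cdot X$ and $(X,Y,Z)=(X\cdot Y)\cdot Z-X\cdot(Y\cdot Z)$. It is associative if $(X,Y,Z)=0$ for all $X,Y,Z$; Novikov if $R_XR_Y=R_YR_X$ for all $X,Y$; bi-symmetric if $(X,Y,Z)=(X,Z,Y)$ for all $X,Y,Z$; complete if every $R_X$ is nilpotent. A name without superscript refers to all admissible parameter values. List on the Lie algebra $\mathfrak g_{3,1}$ with basis $e_1,e_2,e_3$ and only nonzero bracket $[e_1,e_2]=e_3$ (only nonzero products $e_ie_j=e_i\cdot e_j$ given):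 $\mathfrak h_{0,1}$: $e_1e_1=e_1,\ e_1e_2=e_3$. $\mathfrak h_{0,2}$: $e_1e_1=e_2,\ e_1e_2=e_3$. $\mathfrak h_{0,3}$: $e_1e_2=e_3$. $\mathfrak h_{0,4}$: $e_1e_1=e_1,\ e_1e_2=e_2+e_3,\ e_1e_3=e_3,\ e_2e_1=e_2,\ e_3e_1=e_3$. $\mathfrak h_{0,5}$: $e_1e_1=e_2,\ e_1e_2=(1+\lambda)e_3,\ e_2e_1=\lambda e_3$; $\lambda\in\mathbb R\setminus\{0\}$. $\mathfrak h_{0,6}$: $e_1e_2=\frac12e_3,\ e_2e_1=-\frac12e_3$. $\mathfrak h_{1,1}$: $e_1e_1=e_3,\ e_2e_1=-e_3,\ e_2e_2=e_2$. $\mathfrak h_{4,1}$: $e_1e_1=e_3,\ e_1e_2=e_1,\ e_2e_1=e_1-e_3,\ e_2e_2=e_2,\ e_2e_3=e_3,\ e_3e_2=e_3$. $\mathfrak h_{6,1}$: $e_1e_1=\lambda e_3,\ e_1e_2=e_3,\ e_2e_2=e_3$; $\lambda\in\mathbb R\setminus\{0\}$. *)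

theory Defs
  imports "HOL-Analysis.Analysis"
begin

locale lie_algebra =
  fixes bracket :: "'a::real_vector \<Rightarrow> 'a \<Rightarrow> 'a"
  assumes bilinear_bracket: "bilinear bracket"
    and alternating: "bracket x x = 0"
    and jacobi: "bracket x (bracket y z) + bracket y (bracket z x) + bracket z (bracket x y) = 0"

locale flat_lie_algebra = lie_algebra bracket
  for bracket :: "'a::real_vector \<Rightarrow> 'a \<Rightarrow> 'a" +
  fixes prd :: "'a \<Rightarrow> 'a \<Rightarrow> 'a"
  assumes bilinear_prd: "bilinear prd"
    and torsion_free: "prd x y - prd y x = bracket x y"
    and flat: "prd (bracket x y) z = prd x (prd y z) - prd y (prd x z)"

definition right_mult :: "('a \<Rightarrow> 'a \<Rightarrow> 'a) \<Rightarrow> 'a \<Rightarrow> 'a \<Rightarrow> 'a" where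
  "right_mult p x = (\<lambda>y. p y x)"

definition associator :: "('a::real_vector \<Rightarrow> 'a \<Rightarrow> 'a) \<Rightarrow> 'a \<Rightarrow> 'a \<Rightarrow> 'a \<Rightarrow> 'a" where
  "associator p x y z = p (p x y) z - p x (p y z)"

definition associative :: "('a::real_vector \<Rightarrow> 'a \<Rightarrow> 'a) \<Rightarrow> bool" where
  "associative p \<longleftrightarrow> (\<forall>x y z. associator p x y z = 0)"

definition novikov :: "('a \<Rightarrow> 'a \<Rightarrow> 'a) \<Rightarrow> bool" where
  "novikov p \<longleftrightarrow>
    (\<forall>x y. right_mult p x \<circ> right_mult p y = right_mult p y \<circ> right_mult p x)"

definition bi_symmetric :: "('a::real_vector \<Rightarrow> 'a \<Rightarrow> 'a) \<Rightarrow> bool" where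
  "bi_symmetric p \<longleftrightarrow> (\<forall>x y z. associator p x y z = associator p x z y)"

definition nilpotent_map :: "('a::zero \<Rightarrow> 'a) \<Rightarrow> bool" where
  "nilpotent_map f \<longleftrightarrow> (\<exists>n. \<forall>x. (f ^^ n) x = 0)"

definition complete_prd :: "('a::zero \<Rightarrow> 'a \<Rightarrow> 'a) \<Rightarrow> bool" where
  "complete_prd p \<longleftrightarrow> (\<forall>x. nilpotent_map (right_mult p x))"

type_synonym product3 = "real^3 \<Rightarrow> real^3 \<Rightarrow> real^3"

abbreviation bv :: "3 \<Rightarrow> real^3" where
  "bv i \<equiv> axis i 1"

text \<open>
  A table \<open>T\<close> of products of basis vectors is extended bilinearly. Tables are written as
  updates of the zero table, so entries not mentioned are zero. In the index type \<open>3\<close> the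
  numeral \<open>3\<close> denotes the same element as \<open>0\<close>; the indices \<open>1\<close>, \<open>2\<close>, \<open>3\<close> are distinct and
  exhaust the type.
\<close>

definition bilinear_ext :: "(3 \<times> 3 \<Rightarrow> real^3) \<Rightarrow> product3" where
  "bilinear_ext T x y = (\<Sum>i\<in>UNIV. \<Sum>j\<in>UNIV. (x $ i * y $ j) *\<^sub>R T (i, j))"

definition g31_bracket :: product3 where
  "g31_bracket = bilinear_ext ((\<lambda>_. 0)((1,2) := bv 3, (2,1) := - bv 3))"

definition h01 :: product3 where
  "h01 = bilinear_ext ((\<lambda>_. 0)((1,1) := bv 1, (1,2) := bv 3))"

definition h02 :: product3 where
  "h02 = bilinear_ext ((\<lambda>_. 0)((1,1) := bv 2, (1,2) := bv 3))"

definition h03 :: product3 where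
  "h03 = bilinear_ext ((\<lambda>_. 0)((1,2) := bv 3))"

definition h04 :: product3 where
  "h04 = bilinear_ext ((\<lambda>_. 0)((1,1) := bv 1, (1,2) := bv 2 + bv 3, (1,3) := bv 3,
                                (2,1) := bv 2, (3,1) := bv 3))"

definition h05 :: "real \<Rightarrow> product3" where
  "h05 l = bilinear_ext ((\<lambda>_. 0)((1,1) := bv 2, (1,2) := (1 + l) *\<^sub>R bv 3, (2,1) := l *\<^sub>R bv 3))"

definition h06 :: product3 where
  "h06 = bilinear_ext ((\<lambda>_. 0)((1,2) := (1/2) *\<^sub>R bv 3, (2,1) := (- 1/2) *\<^sub>R bv 3))"

definition h11 :: product3 where
  "h11 = bilinear_ext ((\<lambda>_. 0)((1,1) := bv 3, (2,1) := - bv 3, (2,2) := bv 2))"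

definition h41 :: product3 where
  "h41 = bilinear_ext ((\<lambda>_. 0)((1,1) := bv 3, (1,2) := bv 1, (2,1) := bv 1 - bv 3,
                                (2,2) := bv 2, (2,3) := bv 3, (3,2) := bv 3))"

definition h61 :: "real \<Rightarrow> product3" where
  "h61 l = bilinear_ext ((\<lambda>_. 0)((1,1) := l *\<^sub>R bv 3, (1,2) := bv 3, (2,2) := bv 3))"

definition g31_list :: "product3 set" where
  "g31_list = {h01, h02, h03, h04, h06, h11, h41} \<union> {h05 l | l. l \<noteq> 0} \<union> {h61 l | l. l \<noteq> 0}"

lemma bilinear_bilinear_ext: "bilinear (bilinear_ext T)"
  unfolding bilinear_def bilinear_ext_def
  by (auto intro!: linearI simp: sum_3 algebra_simps)

lemma bilinear_ext_expand:
  "bilinear_ext T x y =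
     (x $ 1 * y $ 1) *\<^sub>R T (1,1) + (x $ 1 * y $ 2) *\<^sub>R T (1,2) + (x $ 1 * y $ 3) *\<^sub>R T (1,3) +
     (x $ 2 * y $ 1) *\<^sub>R T (2,1) + (x $ 2 * y $ 2) *\<^sub>R T (2,2) + (x $ 2 * y $ 3) *\<^sub>R T (2,3) +
     (x $ 3 * y $ 1) *\<^sub>R T (3,1) + (x $ 3 * y $ 2) *\<^sub>R T (3,2) + (x $ 3 * y $ 3) *\<^sub>R T (3,3)"
  unfolding bilinear_ext_def sum_3 by (simp only: add.assoc)

lemma axis_nth_3: "axis i c $ j = (if i = j then c else 0)"
  by (simp add: axis_def)

lemma bilinear_ext_basis: "bilinear_ext T (bv i) (bv j) = T (i, j)"
  using exhaust_3[of i] exhaust_3[of j]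
  by (elim disjE) (simp_all add: bilinear_ext_expand axis_nth_3)

lemma product_nth:
  "(g31_bracket x y) $ 1 = 0"
  "(g31_bracket x y) $ 2 = 0"
  "(g31_bracket x y) $ 3 = x$1*y$2 - x$2*y$1"
  "(h01 x y) $ 1 = x$1*y$1"
  "(h01 x y) $ 2 = 0"
  "(h01 x y) $ 3 = x$1*y$2"
  "(h02 x y) $ 1 = 0"
  "(h02 x y) $ 2 = x$1*y$1"
  "(h02 x y) $ 3 = x$1*y$2"
  "(h03 x y) $ 1 = 0"
  "(h03 x y) $ 2 = 0"
  "(h03 x y) $ 3 = x$1*y$2"
  "(h04 x y) $ 1 = x$1*y$1"
  "(h04 x y) $ 2 = x$1*y$2 + x$2*y$1"
  "(h04 x y) $ 3 = x$1*y$2 + x$1*y$3 + x$3*y$1"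
  "(h05 l x y) $ 1 = 0"
  "(h05 l x y) $ 2 = x$1*y$1"
  "(h05 l x y) $ 3 = (1 + l)*x$1*y$2 + l*x$2*y$1"
  "(h06 x y) $ 1 = 0"
  "(h06 x y) $ 2 = 0"
  "(h06 x y) $ 3 = (x$1*y$2 - x$2*y$1) / 2"
  "(h11 x y) $ 1 = 0"
  "(h11 x y) $ 2 = x$2*y$2"
  "(h11 x y) $ 3 = x$1*y$1 - x$2*y$1"
  "(h41 x y) $ 1 = x$1*y$2 + x$2*y$1"
  "(h41 x y) $ 2 = x$2*y$2"
  "(h41 x y) $ 3 = x$1*y$1 - x$2*y$1 + x$2*y$3 + x$3*y$2"
  "(h61 l x y) $ 1 = 0"
  "(h61 l x y) $ 2 = 0"
  "(h61 l x y) $ 3 = l*x$1*y$1 + x$1*y$2 + x$2*y$2"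
  by (simp_all add: bilinear_ext_expand axis_nth_3 algebra_simps diff_divide_distrib
      g31_bracket_def h01_def h02_def h03_def h04_def h05_def h06_def h11_def h41_def h61_def)

lemma bilinear_g31_list: "p \<in> g31_list \<Longrightarrow> bilinear p"
  by (auto simp: g31_list_def bilinear_bilinear_ext
      h01_def h02_def h03_def h04_def h05_def h06_def h11_def h41_def h61_def)

lemma lie_algebra_g31: "lie_algebra g31_bracket"
proof
  show "bilinear g31_bracket"
    by (simp add: g31_bracket_def bilinear_bilinear_ext)
qed (simp_all add: vec_eq_iff forall_3 product_nth)

lemma g31_list_flat:
  assumes "p \<in> g31_list"
  shows "flat_lie_algebra g31_bracket p"
proof (intro flat_lie_algebra.intro flat_lie_algebra_axioms.intro lie_algebra_g31)
  show "bilinear p"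
    using assms by (rule bilinear_g31_list)
  show "p x y - p y x = g31_bracket x y" for x y
    using assms
    by (auto simp: g31_list_def vec_eq_iff forall_3 product_nth algebra_simps)
       (simp_all add: field_simps)
  show "p (g31_bracket x y) z = p x (p y z) - p y (p x z)" for x y z
    using assms
    by (auto simp: g31_list_def vec_eq_iff forall_3 product_nth algebra_simps)
qed

end

theory Submission
  imports Defs
begin

text \<open>In coordinates each property is a polynomial identity. Those that hold are checked with
  \<open>product_nth\<close>, uniformly in the parameter; those that fail already fail on basis
  vectors. For completeness, in \<open>h02\<close>, \<open>h03\<close>, \<open>h05\<close>,
  \<open>h06\<close>, \<open>h61\<close> right multiplications are strictly triangular along e1, e2,
  e3, so their cubes vanish, whereas each remaining product has an idempotent basis vector e, and
  R_e fixes e.\<close>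

lemma novikov_iff: "novikov p \<longleftrightarrow> (\<forall>x y z. p (p z y) x = p (p z x) y)"
  by (auto simp: novikov_def right_mult_def fun_eq_iff)

text \<open>Zero associators are trivially symmetric, so witnesses against bi-symmetry serve twice;
  only \<open>h02\<close> and \<open>h05\<close> need their own witness against
  associativity.\<close>

lemma not_associative_if_not_bi_symmetric: "\<not> bi_symmetric p \<Longrightarrow> \<not> associative p"
  unfolding associative_def bi_symmetric_def by metis

lemma nilpotent_map_fixpoint:
  assumes "nilpotent_map f" "f x = x"
  shows "x = 0"
proof -
  obtain n where "(f ^^ n) x = 0"
    using assms(1) by (auto simp: nilpotent_map_def)
  moreover have "(f ^^ n) x = x"
    by (induction n) (simp_all add: assms(2))
  ultimately show ?thesis by simp
qed

text \<open>Applied below with x = y an idempotent basis vector.\<close>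

lemma not_complete_prd_if_fixpoint: "p y x = y \<Longrightarrow> y \<noteq> 0 \<Longrightarrow> \<not> complete_prd p"
  using nilpotent_map_fixpoint[of "right_mult p x" y]
  by (auto simp: complete_prd_def right_mult_def)

text \<open>Exponent 3 is attained by \<open>h05\<close> with nonzero parameter, where R_e1 sends e1
  to e2, e2 to a multiple of e3, and e3 to 0.\<close>

lemma complete_prd_if_cube_zero: "(\<And>x y. p (p (p y x) x) x = 0) \<Longrightarrow> complete_prd p"
  unfolding complete_prd_def nilpotent_map_def
  by (intro allI exI[of _ 3]) (simp add: numeral_3_eq_3 right_mult_def)

text \<open>Passing to one coordinate leaves a numerical inequality that \<open>product_nth\<close>
  can evaluate.\<close>

lemma not_associative_if_component:
  "associator p x y z $ i \<noteq> 0 \<Longrightarrow> \<not> associative p" for p :: product3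
  unfolding associative_def by (metis zero_index)

lemma not_bi_symmetric_if_component:
  "associator p x y z $ i \<noteq> associator p x z y $ i \<Longrightarrow> \<not> bi_symmetric p" for p :: product3
  unfolding bi_symmetric_def by metis

lemma not_novikov_if_component:
  "p (p z y) x $ i \<noteq> p (p z x) y $ i \<Longrightarrow> \<not> novikov p" for p :: product3
  unfolding novikov_iff by metis

lemma associative_g31:
  "associative h03" "associative h06" "associative (h61 l)"
  by (simp_all add: associative_def associator_def vec_eq_iff forall_3 product_nth)

lemma bi_symmetric_g31:
  "bi_symmetric h02" "bi_symmetric h03" "bi_symmetric (h05 l)" "bi_symmetric h06"
  "bi_symmetric (h61 l)"
  by (simp_all add: bi_symmetric_def associator_def vec_eq_iff forall_3 product_nth algebra_simps)

lemma not_bi_symmetric_g31: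
  "\<not> bi_symmetric h01" "\<not> bi_symmetric h04" "\<not> bi_symmetric h11" "\<not> bi_symmetric h41"
proof -
  show "\<not> bi_symmetric h01" "\<not> bi_symmetric h04"
    \<comment> \<open>(e1,e1,e2) is e3 for \<open>h01\<close> and -e3 for \<open>h04\<close>, while
      (e1,e2,e1) = 0.\<close>
    by (rule not_bi_symmetric_if_component[of _ "bv 1" "bv 1" "bv 2" 3];
        simp add: associator_def product_nth axis_nth_3)+
  show "\<not> bi_symmetric h11" "\<not> bi_symmetric h41"
    \<comment> \<open>(e2,e2,e1) is -e3 for \<open>h11\<close> and e3 for \<open>h41\<close>, while
      (e2,e1,e2) = 0.\<close>
    by (rule not_bi_symmetric_if_component[of _ "bv 2" "bv 2" "bv 1" 3];
        simp add: associator_def product_nth axis_nth_3)+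
qed

text \<open>As e1 e1 = e2, torsion-freeness gives (e1,e1,e1) = [e2,e1] = -e3 for every
  \<open>l\<close>. Its last two arguments coincide, so bi-symmetry is unaffected.\<close>

lemma not_associative_g31:
  "\<not> associative h02" "\<not> associative (h05 l)"
  by (rule not_associative_if_component[of _ "bv 1" "bv 1" "bv 1" 3];
      simp add: associator_def product_nth axis_nth_3)+

lemma novikov_g31:
  "novikov h02" "novikov h03" "novikov h04" "novikov (h05 l)" "novikov h06" "novikov h41"
  "novikov (h61 l)"
  by (simp_all add: novikov_iff vec_eq_iff forall_3 product_nth algebra_simps)

text \<open>In \<open>h01\<close>, (e1 e1) e2 = e3 but (e1 e2) e1 = 0; in \<open>h11\<close>, (e2
  e2) e1 = -e3 but (e2 e1) e2 = 0.\<close>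

lemma not_novikov_g31: "\<not> novikov h01" "\<not> novikov h11"
proof -
  show "\<not> novikov h01"
    by (rule not_novikov_if_component[of _ "bv 1" "bv 1" "bv 2" 3])
       (simp add: product_nth axis_nth_3)
  show "\<not> novikov h11"
    by (rule not_novikov_if_component[of _ "bv 2" "bv 2" "bv 1" 3])
       (simp add: product_nth axis_nth_3)
qed

lemma complete_prd_g31:
  "complete_prd h02" "complete_prd h03" "complete_prd (h05 l)" "complete_prd h06"
  "complete_prd (h61 l)"
  by (rule complete_prd_if_cube_zero; simp add: vec_eq_iff forall_3 product_nth)+

lemma not_complete_prd_g31:
  "\<not> complete_prd h01" "\<not> complete_prd h04" "\<not> complete_prd h11" "\<not> complete_prd h41"
proof -
  show "\<not> complete_prd h01"
    by (rule not_complete_prd_if_fixpoint[of _ "bv 1" "bv 1"])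
       (simp_all add: vec_eq_iff forall_3 product_nth axis_nth_3)
  show "\<not> complete_prd h04"
    by (rule not_complete_prd_if_fixpoint[of _ "bv 1" "bv 1"])
       (simp_all add: vec_eq_iff forall_3 product_nth axis_nth_3)
  show "\<not> complete_prd h11"
    by (rule not_complete_prd_if_fixpoint[of _ "bv 2" "bv 2"])
       (simp_all add: vec_eq_iff forall_3 product_nth axis_nth_3)
  show "\<not> complete_prd h41"
    by (rule not_complete_prd_if_fixpoint[of _ "bv 2" "bv 2"])
       (simp_all add: vec_eq_iff forall_3 product_nth axis_nth_3)
qed

theorem corollary3:
  "{p \<in> g31_list. associative p} =
      {h03, h06} \<union> {h61 l | l. l \<noteq> 0} \<and>
   {p \<in> g31_list. novikov p} =
      {h02, h03, h04, h06, h41} \<union> {h05 l | l. l \<noteq> 0} \<union> {h61 l | l. l \<noteq> 0} \<and>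
   {p \<in> g31_list. bi_symmetric p} =
      {h02, h03, h06} \<union> {h05 l | l. l \<noteq> 0} \<union> {h61 l | l. l \<noteq> 0} \<and>
   {p \<in> g31_list. complete_prd p} =
      {h02, h03, h06} \<union> {h05 l | l. l \<noteq> 0} \<union> {h61 l | l. l \<noteq> 0}"
  unfolding g31_list_def
  by (intro conjI set_eqI)
     (auto simp: associative_g31 not_associative_g31 novikov_g31 not_novikov_g31
       bi_symmetric_g31 not_bi_symmetric_g31 complete_prd_g31 not_complete_prd_g31
       not_bi_symmetric_g31[THEN not_associative_if_not_bi_symmetric])

end
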